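(* Let $X$ be a continuum. If $X$ is a Matea phan, then $X$ is a fan.
   Context: A continuum is a non-empty compact connected metric space; a subcontinuum is a subspace of a continuum which is itself a continuum. An arc is a space homeomorphic to $[0,1]$. Fans: A continuum $Y$ is unicoherent if for any subcontinua $A,B$ of $Y$ with $Y=A\cup B$, the set $A\cap B$ is connected; it is hereditarily unicoherent if each of its subcontinua is unicoherent. A dendroid is an arcwise connected, hereditarily unicoherent continuum. A simple triod is a space homeomorphic to $([-1,1]\times\{0\})\cup(\{0\}\times[0,1])$; its top is the point corresponding to $(0,0)$ under such a homeomorphism. A point $x$ of a dendroid $Y$ is a ramification point of $Y$ if there is a simple triod in $Y$ with top $x$. A fan is a dendroid with at most one ramification point. Phans: Let $X$ be a continuum, $v\in X$ and $\mathcal L$ a collection of arcs in $X$. The pair $(v,\mathcal L)$ is a ramification pair in $X$ if $\bigcup_{L\in\mathcal L}L=X$ and, for all $L_1,L_2\in\mathcal L$ with $L_1\neq L_2$, $L_1\cap L_2=\{v\}$; in this case $X$ is called a pan with respect to $(v,\mathcal L)$. A phan with respect to $(v,\mathcal L)$ is a pan $X$ with respect to $(v,\mathcal L)$ such that $\dim(X)=1$, where $\dim$ is the small inductive dimension. Matea phans: Let $X$ be a phan with respect to $(v,\mathcal L)$. If $x\ne y$ are points of $X$ lying in a common $L\in\mathcal L$, then $[x,y]_{(v,\mathcal L)}$ denotes the arc in $L$ with end-points $x$ and $y$; and $[x,x]_{(v,\mathcal L)}=\{x\}$. A subcontinuum $B$ of $X$ is $(v,\mathcal L)$-star if $[v,b]_{(v,\mathcal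 L)}\subseteq B$ for each $b\in B$. A continuum is contractible if its identity map is homotopic (within the continuum) to a constant map. $X$ is a Matea phan with respect to $(v,\mathcal L)$ if for each sequence $(L_n)$ in $\mathcal L$ that converges, in the Hausdorff metric on the non-empty closed subsets of $X$, to a subcontinuum $B$ of $X$, the continuum $B$ is contractible and $(v,\mathcal L)$-star. $X$ is a Matea phan if it is a Matea phan with respect to some $(v,\mathcal L)$. *)

theory Defs
  imports "HOL-Analysis.Analysis"
begin

text \<open>
  Every space is a subset of a metric space type with the subspace metric. This covers all
  metric spaces, since the carrier may be the whole type.
\<close>

definition continuum :: "'a::metric_space set \<Rightarrow> bool" where
  "continuum X \<longleftrightarrow> X \<noteq> {} \<and> compact X \<and> connected X"

definition subcontinuum :: "'a::metric_space set \<Rightarrow> 'a set \<Rightarrow> bool" where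
  "subcontinuum A X \<longleftrightarrow> A \<subseteq> X \<and> continuum A"

definition is_arc :: "'a::metric_space set \<Rightarrow> bool" where
  "is_arc A \<longleftrightarrow> A homeomorphic {0..1::real}"

definition arc_with_ends :: "'a::metric_space set \<Rightarrow> 'a \<Rightarrow> 'a \<Rightarrow> bool" where
  "arc_with_ends A x y \<longleftrightarrow> (\<exists>f g. homeomorphism {0..1::real} A f g \<and> f 0 = x \<and> f 1 = y)"

definition arcwise_connected :: "'a::metric_space set \<Rightarrow> bool" where
  "arcwise_connected X \<longleftrightarrow> (\<forall>x\<in>X. \<forall>y\<in>X. x \<noteq> y \<longrightarrow> (\<exists>A\<subseteq>X. arc_with_ends A x y))"


subsection \<open>Fans\<close>

definition unicoherent :: "'a::metric_space set \<Rightarrow> bool" where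
  "unicoherent Y \<longleftrightarrow>
     (\<forall>A B. subcontinuum A Y \<and> subcontinuum B Y \<and> Y = A \<union> B \<longrightarrow> connected (A \<inter> B))"

definition hereditarily_unicoherent :: "'a::metric_space set \<Rightarrow> bool" where
  "hereditarily_unicoherent Y \<longleftrightarrow> (\<forall>Z. subcontinuum Z Y \<longrightarrow> unicoherent Z)"

definition dendroid :: "'a::metric_space set \<Rightarrow> bool" where
  "dendroid Y \<longleftrightarrow> continuum Y \<and> arcwise_connected Y \<and> hereditarily_unicoherent Y"

definition standard_triod :: "(real \<times> real) set" where
  "standard_triod = ({-1..1} \<times> {0}) \<union> ({0} \<times> {0..1})"

definition simple_triod_with_top :: "'a::metric_space set \<Rightarrow> 'a \<Rightarrow> bool" where
  "simple_triod_with_top T x \<longleftrightarrow> (\<exists>f g. homeomorphism standard_triod T f g \<and> f (0, 0) = x)"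

definition ramification_point :: "'a::metric_space set \<Rightarrow> 'a \<Rightarrow> bool" where
  "ramification_point Y x \<longleftrightarrow> x \<in> Y \<and> (\<exists>T\<subseteq>Y. simple_triod_with_top T x)"

definition fan :: "'a::metric_space set \<Rightarrow> bool" where
  "fan Y \<longleftrightarrow>
     dendroid Y \<and> (\<forall>x y. ramification_point Y x \<and> ramification_point Y y \<longrightarrow> x = y)"


subsection \<open>Phans\<close>

definition ramification_pair :: "'a::metric_space set \<Rightarrow> 'a \<Rightarrow> 'a set set \<Rightarrow> bool" where
  "ramification_pair X v \<L> \<longleftrightarrow>
     v \<in> X \<and> (\<forall>L\<in>\<L>. L \<subseteq> X \<and> is_arc L) \<and> \<Union>\<L> = X \<and>
     (\<forall>L1\<in>\<L>. \<forall>L2\<in>\<L>. L1 \<noteq> L2 \<longrightarrow> L1 \<inter> L2 = {v})"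

definition pan :: "'a::metric_space set \<Rightarrow> 'a \<Rightarrow> 'a set set \<Rightarrow> bool" where
  "pan X v \<L> \<longleftrightarrow> continuum X \<and> ramification_pair X v \<L>"

text \<open>\<open>dim_le\<close> is the library's small inductive dimension relation.\<close>

definition has_dimension :: "'a::metric_space set \<Rightarrow> int \<Rightarrow> bool" where
  "has_dimension X n \<longleftrightarrow> top_of_set X dim_le n \<and> \<not> top_of_set X dim_le (n - 1)"

definition phan :: "'a::metric_space set \<Rightarrow> 'a \<Rightarrow> 'a set set \<Rightarrow> bool" where
  "phan X v \<L> \<longleftrightarrow> pan X v \<L> \<and> has_dimension X 1"


subsection \<open>Matea phans\<close>

text \<open>
  For a pan and distinct \<open>x\<close>, \<open>y\<close> in a common member of \<open>\<L>\<close>, that member is unique because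
  distinct members share only one point, and an arc contains exactly one arc with two given
  end-points; so the description below determines a unique set. The vertex plays no role in it.
\<close>

definition pan_segment :: "'a::metric_space set set \<Rightarrow> 'a \<Rightarrow> 'a \<Rightarrow> 'a set" where
  "pan_segment \<L> x y =
     (if x = y then {x}
      else (THE A. \<exists>L\<in>\<L>. x \<in> L \<and> y \<in> L \<and> A \<subseteq> L \<and> arc_with_ends A x y))"

definition star_subcontinuum ::
    "'a::metric_space set \<Rightarrow> 'a \<Rightarrow> 'a set set \<Rightarrow> 'a set \<Rightarrow> bool" where
  "star_subcontinuum X v \<L> B \<longleftrightarrow> subcontinuum B X \<and> (\<forall>b\<in>B. pan_segment \<L> v b \<subseteq> B)"

text \<open>Meaningful for non-empty bounded sets only; it is applied to compact ones.\<close>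

definition hausdorff_dist :: "'a::metric_space set \<Rightarrow> 'a set \<Rightarrow> real" where
  "hausdorff_dist A B = max (SUP a\<in>A. infdist a B) (SUP b\<in>B. infdist b A)"

definition Matea_phan_wrt :: "'a::metric_space set \<Rightarrow> 'a \<Rightarrow> 'a set set \<Rightarrow> bool" where
  "Matea_phan_wrt X v \<L> \<longleftrightarrow>
     phan X v \<L> \<and>
     (\<forall>L B. (\<forall>n::nat. L n \<in> \<L>) \<and> subcontinuum B X \<and>
            (\<lambda>n. hausdorff_dist (L n) B) \<longlonglongrightarrow> 0 \<longrightarrow>
            contractible B \<and> star_subcontinuum X v \<L> B)"

definition Matea_phan :: "'a::metric_space set \<Rightarrow> bool" where
  "Matea_phan X \<longleftrightarrow> (\<exists>v \<L>. Matea_phan_wrt X v \<L>)"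

end

theory Submission
  imports Defs
begin

text \<open>
  Every continuous \<open>f : X \<rightarrow> \<complex> - {0}\<close> on a Matea phan has a continuous logarithm. Lift \<open>f\<close> along each
  arc of \<open>\<L>\<close> with a common value at \<open>v\<close>. If \<open>x\<^sub>n \<longlonglongrightarrow> a\<close> with \<open>x\<^sub>n \<in> L\<^sub>n\<close>, a subsequence of the \<open>L\<^sub>n\<close> converges
  to a continuum \<open>B\<close>; contractibility gives a logarithm on \<open>B\<close>, hence on a neighbourhood of \<open>B\<close>, which
  agrees with the lift on \<open>L\<^sub>n\<close> for large \<open>n\<close> and, \<open>B\<close> being a star, at \<open>a\<close>. So the lift is continuous.
  Since \<open>dim X \<le> 1\<close>, subcontinua with disconnected intersection would produce a function without a
  logarithm, so any two subcontinua meet in a connected set. In particular a continuum that avoids \<open>v\<close>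
  stays in one arc, which leaves \<open>v\<close> as the only possible ramification point.
\<close>

subsection \<open>Continuous logarithms\<close>

text \<open>Two lifts through the covering \<open>exp\<close> of the punctured plane cannot part on
  a connected set. This later identifies logarithms near a limit continuum with the lifts along arcs
  from \<open>v\<close>.\<close>

lemma continuous_logarithm_unique:
  fixes g h :: "'a::topological_space \<Rightarrow> complex"
  assumes "connected S" "continuous_on S g" "continuous_on S h"
    and "\<And>x. x \<in> S \<Longrightarrow> exp (g x) = exp (h x)" and "a \<in> S" "g a = h a" "x \<in> S"
  shows "g x = h x"
proof (rule covering_space_lift_unique[OF covering_space_exp_punctured_plane, of g a h S "\<lambda>x. exp (g x)"])
  show "continuous_on S (\<lambda>x. exp (g x))"
    using assms by (intro continuous_intros)
qed (use assms in auto)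

text \<open>The hypothesis places \<open>f x / g x\<close> in the open unit disc about 1, hence in
  the right half-plane, away from the branch cut of \<open>Ln\<close>.\<close>

lemma exp_Ln_quotient_near_1:
  fixes f g :: "'a::topological_space \<Rightarrow> complex"
  assumes f: "continuous_on S f" and g: "continuous_on S g"
    and near: "\<And>x. x \<in> S \<Longrightarrow> dist (f x) (g x) < norm (g x)"
  shows "continuous_on S (\<lambda>x. Ln (f x / g x))"
    and "\<And>x. x \<in> S \<Longrightarrow> exp (Ln (f x / g x)) = f x / g x"
proof -
  have pos: "Re (f x / g x) > 0" if "x \<in> S" for x
  proof -
    have gnz: "g x \<noteq> 0"
      using near[OF that] by auto
    have "norm (f x / g x - 1) = norm (f x - g x) / norm (g x)"
      using gnz by (simp add: norm_divide[symmetric] diff_divide_distrib)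
    also have "\<dots> < 1"
      using near[OF that] gnz by (simp add: dist_norm divide_simps)
    finally have "\<bar>Re (f x / g x - 1)\<bar> < 1"
      using abs_Re_le_cmod le_less_trans by blast
    then show ?thesis
      by simp
  qed
  have gnz: "g x \<noteq> 0" if "x \<in> S" for x
    using near[OF that] by auto
  show "exp (Ln (f x / g x)) = f x / g x" if "x \<in> S" for x
    using pos[OF that] by (intro exp_Ln) auto
  have "f x / g x \<notin> \<real>\<^sub>\<le>\<^sub>0" if "x \<in> S" for x
    using pos[OF that] by (auto simp: complex_nonpos_Reals_iff)
  then show "continuous_on S (\<lambda>x. Ln (f x / g x))"
    using gnz by (intro continuous_intros f g) auto
qed

text \<open>The logarithm \<open>g\<close> of a nearby function is corrected by
  \<open>Ln (f / exp g)\<close>. Since \<open>Ln 1 = 0\<close>, nothing changes where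
  \<open>g\<close> is already right; the extension off a compact set relies on this.\<close>

lemma continuous_logarithm_near:
  fixes f g :: "'a::topological_space \<Rightarrow> complex"
  assumes f: "continuous_on S f" and g: "continuous_on S g"
    and near: "\<And>x. x \<in> S \<Longrightarrow> dist (f x) (exp (g x)) < norm (exp (g x))"
  obtains h where "continuous_on S h" "\<And>x. x \<in> S \<Longrightarrow> exp (h x) = f x"
    "\<And>x. \<lbrakk>x \<in> S; f x = exp (g x)\<rbrakk> \<Longrightarrow> h x = g x"
proof
  have e: "continuous_on S (\<lambda>x. exp (g x))"
    by (intro continuous_intros g)
  have q: "continuous_on S (\<lambda>x. Ln (f x / exp (g x)))"
    "\<And>x. x \<in> S \<Longrightarrow> exp (Ln (f x / exp (g x))) = f x / exp (g x)"
    using exp_Ln_quotient_near_1[OF f e] near by blast+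
  show "continuous_on S (\<lambda>x. g x + Ln (f x / exp (g x)))"
    by (intro continuous_intros g q(1))
  show "exp (g x + Ln (f x / exp (g x))) = f x" if "x \<in> S" for x
    using q(2)[OF that] by (simp add: exp_add)
qed auto

text \<open>
  The library has this for subsets of normed spaces. Here the homotopy is cut into steps that move
  the values of the function by less than its minimum modulus.
\<close>

lemma continuous_logarithm_on_compact_contractible:
  fixes f :: "'a::metric_space \<Rightarrow> complex"
  assumes S: "compact S" "contractible S" and f: "continuous_on S f"
    and nz: "\<And>x. x \<in> S \<Longrightarrow> f x \<noteq> 0"
  obtains g where "continuous_on S g" "\<And>x. x \<in> S \<Longrightarrow> exp (g x) = f x"
proof (cases "S = {}")
  case True
  then show ?thesis using that by auto
next
  case False
  obtain a h where h: "continuous_map (prod_topology (top_of_set {0..1::real}) (top_of_set S)) (top_of_set S) h"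
    and h0: "\<And>x. h (0, x) = x" and h1: "\<And>x. h (1, x) = a"
    using S(2) unfolding contractible_def homotopic_with_def by auto
  have hc: "continuous_on ({0..1} \<times> S) h" and hS: "h ` ({0..1} \<times> S) \<subseteq> S"
    using h by (auto simp flip: subtopology_Times euclidean_product_topology simp: continuous_map_in_subtopology)
  define k where "k = f \<circ> h"
  have kc: "continuous_on ({0..1} \<times> S) k"
    unfolding k_def using hc hS f by (meson continuous_on_compose continuous_on_subset)
  have cpt: "compact ({0..1::real} \<times> S)"
    using S by (intro compact_Times) auto
  have knz: "k p \<noteq> 0" if "p \<in> {0..1} \<times> S" for p
    unfolding k_def o_def using nz hS that by blast
  \<comment> \<open>The least modulus over the whole homotopy is a tolerance that works at every
    time and point.\<close>
  obtain p0 where p0: "p0 \<in> {0..1} \<times> S" and p0min: "\<And>p. p \<in> {0..1} \<times> S \<Longrightarrow> norm (k p0) \<le> norm (k p)"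
    using continuous_attains_inf[OF cpt _ continuous_on_norm[OF kc]] False by fastforce
  have mpos: "norm (k p0) > 0"
    using knz[OF p0] by simp
  obtain d where "d > 0" and d: "\<And>p q. \<lbrakk>p \<in> {0..1} \<times> S; q \<in> {0..1} \<times> S; dist q p < d\<rbrakk>
      \<Longrightarrow> dist (k q) (k p) < norm (k p0)"
    using compact_uniformly_continuous[OF kc cpt] mpos unfolding uniformly_continuous_on_def by metis
  obtain N :: nat where N: "N > 0" "1 / real N < d"
    using \<open>d > 0\<close> by (metis nat_approx_posE of_nat_0_less_iff zero_less_Suc)
  \<comment> \<open>The induction runs backwards in time: \<open>i = 0\<close> is the constant end
    of the homotopy, \<open>i = N\<close> is \<open>f\<close> itself.\<close>
  have "\<exists>g. continuous_on S g \<and> (\<forall>x\<in>S. exp (g x) = k (1 - real i / real N, x))" if "i \<le> N" for i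
    using that
  proof (induction i)
    case 0
    have "f a \<noteq> 0"
      using knz[of "(1, SOME x. x \<in> S)"] False by (auto simp: k_def h1 some_in_eq)
    then show ?case
      by (intro exI[of _ "\<lambda>x. Ln (f a)"]) (auto simp: k_def h1)
  next
    case (Suc i)
    then obtain g where g: "continuous_on S g" "\<And>x. x \<in> S \<Longrightarrow> exp (g x) = k (1 - real i / real N, x)"
      by auto
    let ?s = "1 - real i / real N" and ?t = "1 - real (Suc i) / real N"
    have st: "?s \<in> {0..1}" "?t \<in> {0..1}"
      using Suc.prems N by (auto simp: divide_simps)
    have "continuous_on S (\<lambda>x. k (?t, x))"
      using st by (intro continuous_on_compose2[OF kc] continuous_intros) auto
    moreover have "dist (k (?t, x)) (exp (g x)) < norm (exp (g x))" if "x \<in> S" for x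
    proof -
      have "dist (?t, x) (?s, x) = 1 / real N"
        by (simp add: dist_Pair_Pair dist_real_def add_divide_distrib)
      then have "dist (k (?t, x)) (k (?s, x)) < norm (k p0)"
        using d[of "(?s, x)" "(?t, x)"] N st that by auto
      also have "\<dots> \<le> norm (k (?s, x))"
        using p0min st that by auto
      finally show ?thesis
        using g(2)[OF that] by simp
    qed
    ultimately show ?case
      using continuous_logarithm_near[of S "\<lambda>x. k (?t, x)" g] g(1) by metis
  qed
  from this[of N] obtain g where "continuous_on S g" "\<And>x. x \<in> S \<Longrightarrow> exp (g x) = k (0, x)"
    using N by auto
  then show ?thesis
    using that by (auto simp: k_def h0)
qed

section \<open>Logarithms on arcs and near compact sets\<close>

lemma is_arc_continuum:
  assumes "is_arc L" shows "continuum L"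
proof -
  obtain f g where "homeomorphism {0..1::real} L f g"
    using assms unfolding is_arc_def by (meson homeomorphic_def homeomorphic_sym)
  then have "L = f ` {0..1}" "continuous_on {0..1} f"
    by (auto simp: homeomorphism_def)
  then show ?thesis
    unfolding continuum_def
    by (auto intro: compact_continuous_image connected_continuous_image)
qed

lemma continuous_logarithm_on_arc:
  fixes f :: "'a::metric_space \<Rightarrow> complex"
  assumes L: "is_arc L" and f: "continuous_on L f" and nz: "\<And>x. x \<in> L \<Longrightarrow> f x \<noteq> 0"
    and a: "a \<in> L" and c: "exp c = f a"
  obtains g where "continuous_on L g" "\<And>x. x \<in> L \<Longrightarrow> exp (g x) = f x" "g a = c"
proof -
  obtain p q where pq: "homeomorphism L {0..1::real} p q"
    using L unfolding is_arc_def homeomorphic_def by auto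
  have "continuous_on {0..1} (f \<circ> q)"
    using pq f by (metis continuous_on_compose homeomorphism_def)
  moreover have "contractible {0..1::real}"
    by (simp add: convex_imp_contractible)
  moreover have "(f \<circ> q) t \<noteq> 0" if "t \<in> {0..1}" for t
    using nz pq that by (metis comp_apply homeomorphism_def imageI)
  ultimately obtain g where g: "continuous_on {0..1} g" "\<And>t. t \<in> {0..1} \<Longrightarrow> (f \<circ> q) t = exp (g t)"
    using continuous_logarithm_on_contractible by metis
  show ?thesis
  proof
    \<comment> \<open>The added constant has exponential 1, so it changes only the value at
      \<open>a\<close>, to the prescribed \<open>c\<close>.\<close>
    show "continuous_on L (\<lambda>x. g (p x) + (c - g (p a)))"
      using pq g(1) by (intro continuous_intros continuous_on_compose2[OF g(1)]) (auto simp: homeomorphism_def)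
    have *: "exp (g (p x)) = f x" if "x \<in> L" for x
      using g(2)[of "p x"] pq that by (auto simp: homeomorphism_def)
    show "exp (g (p x) + (c - g (p a))) = f x" if "x \<in> L" for x
      using *[OF that] *[OF a] nz[OF a] c by (simp add: exp_add exp_diff)
  qed simp
qed

text \<open>Tietze extends the real and imaginary parts of \<open>g\<close> to \<open>X\<close>. The
  extension need not be a logarithm off \<open>B\<close>, but it is nearly one on a neighbourhood,
  where it can be corrected.\<close>

lemma continuous_logarithm_extend_nhd:
  fixes f :: "'a::metric_space \<Rightarrow> complex"
  assumes f: "continuous_on X f" and BX: "B \<subseteq> X" and B: "compact B"
    and g: "continuous_on B g" and eg: "\<And>x. x \<in> B \<Longrightarrow> exp (g x) = f x"
  obtains U h where "openin (top_of_set X) U" "B \<subseteq> U" "continuous_on U h"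
    "\<And>x. x \<in> U \<Longrightarrow> exp (h x) = f x" "\<And>x. x \<in> B \<Longrightarrow> h x = g x"
proof -
  have ext: "\<exists>G. continuous_on X G \<and> (\<forall>x\<in>B. G x = r x)" if r: "continuous_on B r" for r :: "'a \<Rightarrow> real"
  proof -
    have n: "normal_space (top_of_set X)"
      by (simp add: metrizable_imp_normal_space metrizable_space_subtopology metrizable_space_euclidean)
    have c: "closedin (top_of_set X) B"
      using B BX by (simp add: closed_subset compact_imp_closed)
    have "continuous_map (subtopology (top_of_set X) B) euclideanreal r"
      using r BX by (simp add: subtopology_subtopology Int_absorb1)
    from Tietze_extension_realinterval[OF n c is_interval_univ _ this]
    obtain G where "continuous_map (top_of_set X) euclideanreal G" "\<And>x. x \<in> B \<Longrightarrow> G x = r x"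
      by auto
    then show ?thesis by auto
  qed
  obtain G1 where G1: "continuous_on X G1" "\<And>x. x \<in> B \<Longrightarrow> G1 x = Re (g x)"
    using ext[OF continuous_on_Re[OF g]] by auto
  obtain G2 where G2: "continuous_on X G2" "\<And>x. x \<in> B \<Longrightarrow> G2 x = Im (g x)"
    using ext[OF continuous_on_Im[OF g]] by auto
  define G where "G x = Complex (G1 x) (G2 x)" for x
  have G: "continuous_on X G"
    unfolding G_def Complex_eq by (intro continuous_intros G1 G2)
  have Gg: "G x = g x" if "x \<in> B" for x
    using that by (simp add: G_def G1 G2)
  \<comment> \<open>This is the nearness condition of \<open>continuous_logarithm_near\<close>. It
    holds on \<open>B\<close>, where the distance is 0 and \<open>exp\<close> does not
    vanish.\<close>
  define U where "U = {x \<in> X. dist (f x) (exp (G x)) - norm (exp (G x)) < 0}"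
  have cU: "continuous_on X (\<lambda>x. dist (f x) (exp (G x)) - norm (exp (G x)))"
    by (intro continuous_intros f G)
  have U: "openin (top_of_set X) U"
    using continuous_openin_preimage_gen[OF cU open_lessThan[of 0]]
    by (simp add: U_def vimage_def Collect_conj_eq)
  have UX: "U \<subseteq> X"
    by (auto simp: U_def)
  obtain h where h: "continuous_on U h" "\<And>x. x \<in> U \<Longrightarrow> exp (h x) = f x"
    "\<And>x. \<lbrakk>x \<in> U; f x = exp (G x)\<rbrakk> \<Longrightarrow> h x = G x"
    using continuous_logarithm_near[OF continuous_on_subset[OF f UX] continuous_on_subset[OF G UX]]
    by (auto simp: U_def)
  have BU: "B \<subseteq> U"
    using BX eg by (auto simp: U_def Gg)
  show ?thesis
    using that[OF U BU h(1,2)] h(3) BU eg Gg by (metis subsetD)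
qed


subsection \<open>Hausdorff limits of continua\<close>

text \<open>Finite nets of mesh \<open>1 / Suc n\<close>, one for each \<open>n\<close>, have a
  countable union, which is then enumerated.\<close>

lemma compact_dense_sequence:
  fixes X :: "'a::metric_space set"
  assumes "compact X" "X \<noteq> {}"
  obtains D :: "nat \<Rightarrow> 'a" where "range D \<subseteq> X" "\<And>x e. \<lbrakk>x \<in> X; e > 0\<rbrakk> \<Longrightarrow> \<exists>k. dist (D k) x < e"
proof -
  have "\<exists>k. finite k \<and> k \<subseteq> X \<and> X \<subseteq> (\<Union>x\<in>k. ball x (1 / real (Suc n)))" for n
    using seq_compact_imp_totally_bounded[of X] assms(1)
    by (simp add: compact_eq_seq_compact_metric del: of_nat_Suc)
  then obtain k where k: "\<And>n. finite (k n)" "\<And>n. k n \<subseteq> X" "\<And>n. X \<subseteq> (\<Union>x\<in>k n. ball x (1 / real (Suc n)))"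
    by metis
  define E where "E = (\<Union>n. k n)"
  have "countable E"
    unfolding E_def using k(1) by (intro countable_UN) (auto intro: countable_finite)
  moreover have "E \<noteq> {}"
    unfolding E_def using k(3)[of 0] assms(2) by auto
  ultimately have r: "range (from_nat_into E) = E"
    by (simp add: range_from_nat_into)
  show ?thesis
  proof
    show "range (from_nat_into E) \<subseteq> X"
      using r k(2) by (auto simp: E_def)
    fix x and e :: real assume x: "x \<in> X" and "e > 0"
    then obtain n where n: "1 / real (Suc n) < e"
      using nat_approx_posE by blast
    obtain y where "y \<in> k n" "dist y x < 1 / real (Suc n)"
      using k(3)[of n] x by auto
    moreover then have "y \<in> range (from_nat_into E)"
      using r by (auto simp: E_def)
    ultimately show "\<exists>j. dist (from_nat_into E j) x < e"
      using n by (metis imageE less_trans)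
  qed
qed

text \<open>In place of a diagonal argument: the product of countably many copies of
  \<open>{a..b}\<close> is compact and metrizable, hence sequentially compact.\<close>

lemma bounded_sequences_subseq_pointwise_convergent:
  fixes u :: "nat \<Rightarrow> nat \<Rightarrow> real"
  assumes "\<And>n k. u n k \<in> {a..b}"
  obtains r where "strict_mono r" "\<And>k. convergent (\<lambda>n. u (r n) k)"
proof -
  have "compactin (product_topology (\<lambda>_::nat. euclidean) UNIV) (PiE UNIV (\<lambda>_. {a..b}))"
    by (subst compactin_PiE) auto
  then have "compact (PiE UNIV (\<lambda>_::nat. {a..b}))"
    by (simp add: euclidean_product_topology)
  then have "seq_compact (PiE UNIV (\<lambda>_::nat. {a..b}))"
    by (simp add: compact_eq_seq_compact_metric)
  then obtain l r where "strict_mono r" "(u \<circ> r) \<longlonglongrightarrow> l"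
    unfolding seq_compact_def using assms by (metis PiE_UNIV_domain UNIV_I Pi_I)
  moreover then have "(\<lambda>n. u (r n) k) \<longlonglongrightarrow> l k" for k
    using continuous_on_tendsto_compose[OF continuous_on_product_coordinates, of "u \<circ> r" l sequentially k]
    by (simp add: o_def)
  ultimately show ?thesis
    using that unfolding convergent_def by blast
qed

text \<open>An Arzela-Ascoli argument: distance functions are 1-Lipschitz and bounded by the
  diameter, so convergence on a dense sequence forces uniform convergence.\<close>

lemma infdist_subseq_uniformly_convergent:
  fixes X :: "'a::metric_space set"
  assumes X: "compact X" "X \<noteq> {}" and L: "\<And>n::nat. L n \<subseteq> X" "\<And>n. L n \<noteq> {}"
  obtains r h where "strict_mono r" "uniform_limit X (\<lambda>n x. infdist x (L (r n))) h sequentially"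
proof -
  obtain D where D: "range D \<subseteq> X" "\<And>x e. \<lbrakk>x \<in> X; e > 0\<rbrakk> \<Longrightarrow> \<exists>k::nat. dist (D k) x < e"
    using compact_dense_sequence[OF X] by blast
  have "infdist (D k) (L n) \<in> {0..diameter X}" for n k
  proof -
    obtain y where "y \<in> L n" using L(2) by auto
    then show ?thesis
      using D(1) L(1) infdist_nonneg X compact_imp_bounded
      by (auto intro!: infdist_le2[of y] diameter_bounded_bound)
  qed
  from bounded_sequences_subseq_pointwise_convergent[of "\<lambda>n k. infdist (D k) (L n)", OF this]
  obtain r where r: "strict_mono r" and conv: "\<And>k. convergent (\<lambda>n. infdist (D k) (L (r n)))"
    by blast
  have "uniformly_Cauchy_on X (\<lambda>n x. infdist x (L (r n)))"
  proof (rule uniformly_Cauchy_onI')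
    fix e :: real assume e: "e > 0"
    \<comment> \<open>Finitely many centres suffice. Moving to a centre, comparing there and moving
      back each cost less than \<open>e/4\<close>.\<close>
    have "X \<subseteq> (\<Union>k. ball (D k) (e/4))"
      using D(2)[of _ "e/4"] e by auto
    then obtain K where K: "finite K" "X \<subseteq> (\<Union>k\<in>K. ball (D k) (e/4))"
      using compactE_image[OF X(1), of UNIV "\<lambda>k. ball (D k) (e/4)"] by auto
    have "\<exists>M. \<forall>m\<ge>M. \<forall>n\<ge>M. dist (infdist (D k) (L (r m))) (infdist (D k) (L (r n))) < e/4" for k
      using metric_CauchyD[OF convergent_Cauchy[OF conv[of k]], of "e/4"] e by simp
    then obtain M where M: "\<And>k m n. \<lbrakk>m \<ge> M k; n \<ge> M k\<rbrakk> \<Longrightarrow>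
        dist (infdist (D k) (L (r m))) (infdist (D k) (L (r n))) < e/4"
      by metis
    have "dist (infdist x (L (r m))) (infdist x (L (r n))) < e"
      if x: "x \<in> X" and m: "m \<ge> Max (M ` K)" and n: "n > m" for x m n
    proof -
      obtain k where k: "k \<in> K" "dist (D k) x < e/4"
        using K(2) x by auto
      have "m \<ge> M k" "n \<ge> M k"
        using m n k(1) K(1) by (meson Max_ge finite_imageI imageI le_trans less_imp_le)+
      from M[OF this] show ?thesis
        using k(2) infdist_triangle_abs[of x "L (r m)" "D k"] infdist_triangle_abs[of x "L (r n)" "D k"]
        unfolding dist_real_def dist_commute[of "D k"] by linarith
    qed
    then show "\<exists>M. \<forall>x\<in>X. \<forall>m\<ge>M. \<forall>n>m. dist (infdist x (L (r m))) (infdist x (L (r n))) < e"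
      by blast
  qed
  then show ?thesis
    using that r Cauchy_uniformly_convergent uniformly_convergent_on_def by blast
qed

lemma hausdorff_dist_tendsto_0:
  fixes B :: "'a::metric_space set"
  assumes B: "B \<noteq> {}" and L: "\<And>n. L n \<noteq> {}"
    and "\<And>e. e > 0 \<Longrightarrow> \<forall>\<^sub>F n in F. \<forall>x\<in>L n. infdist x B < e"
    and "\<And>e. e > 0 \<Longrightarrow> \<forall>\<^sub>F n in F. \<forall>x\<in>B. infdist x (L n) < e"
  shows "((\<lambda>n. hausdorff_dist (L n) B) \<longlongrightarrow> 0) F"
proof (rule tendstoI)
  fix e :: real assume "e > 0"
  then have "\<forall>\<^sub>F n in F. (\<forall>x\<in>L n. infdist x B < e/2) \<and> (\<forall>x\<in>B. infdist x (L n) < e/2)"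
    using assms(3,4)[of "e/2"] by (simp add: eventually_conj)
  then show "\<forall>\<^sub>F n in F. dist (hausdorff_dist (L n) B) 0 < e"
  proof eventually_elim
    case (elim n)
    \<comment> \<open>A supremum loses strictness, hence the bound \<open>e/2\<close>. The fact
      serves both halves of the maximum.\<close>
    have sup: "0 \<le> (SUP a\<in>S. infdist a T) \<and> (SUP a\<in>S. infdist a T) \<le> e/2"
      if S: "S \<noteq> {}" "\<forall>x\<in>S. infdist x T < e/2" for S T :: "'a set"
    proof
      show "(SUP a\<in>S. infdist a T) \<le> e/2"
        using that by (intro cSUP_least) (auto intro: less_imp_le)
      obtain x where "x \<in> S" using S by auto
      moreover have "bdd_above ((\<lambda>a. infdist a T) ` S)"
        using that by (intro bdd_aboveI2[of _ _ "e/2"]) (auto intro: less_imp_le)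
      ultimately show "0 \<le> (SUP a\<in>S. infdist a T)"
        by (meson cSUP_upper2 infdist_nonneg)
    qed
    from sup[of "L n" B] sup[of B "L n"] elim B L \<open>e > 0\<close> show ?case
      by (auto simp: hausdorff_dist_def dist_real_def)
  qed
qed

text \<open>\<open>B\<close> is the zero set of the uniform limit of the distance functions. The
  last two conclusions are what the lifting argument uses directly: the continua eventually leave
  compact sets disjoint from \<open>B\<close>, and common points such as the vertex survive in
  \<open>B\<close>.\<close>

lemma continua_hausdorff_convergent_subseq:
  fixes X :: "'a::metric_space set"
  assumes X: "compact X" and L: "\<And>n::nat. subcontinuum (L n) X"
  obtains r B where "strict_mono r" "subcontinuum B X" "(\<lambda>n. hausdorff_dist (L (r n)) B) \<longlonglongrightarrow> 0"
    "\<And>C. \<lbrakk>compact C; C \<subseteq> X; C \<inter> B = {}\<rbrakk> \<Longrightarrow> \<forall>\<^sub>F n in sequentially. L (r n) \<inter> C = {}"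
    "\<And>x. (\<And>n. x \<in> L n) \<Longrightarrow> x \<in> B"
proof -
  have LX: "L n \<subseteq> X" and Lne: "L n \<noteq> {}" and Lcomp: "compact (L n)" and Lconn: "connected (L n)" for n
    using L[of n] by (auto simp: subcontinuum_def continuum_def)
  have "X \<noteq> {}"
    using LX[of 0] Lne[of 0] by auto
  then obtain r h where r: "strict_mono r"
    and lim: "uniform_limit X (\<lambda>n x. infdist x (L (r n))) h sequentially"
    using infdist_subseq_uniformly_convergent[OF X, of L] LX Lne by blast
  have h: "continuous_on X h"
    by (rule uniform_limit_theorem[OF _ lim]) (auto intro!: always_eventually continuous_intros)
  have hlim: "(\<lambda>n. infdist x (L (r n))) \<longlonglongrightarrow> h x" if "x \<in> X" for x
    using tendsto_uniform_limitI[OF lim that] .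
  have h0: "h x \<ge> 0" if "x \<in> X" for x
    by (rule tendsto_lowerbound[OF hlim[OF that]]) (auto simp: infdist_nonneg)
  define B where "B = {x \<in> X. h x = 0}"
  have BX: "B \<subseteq> X"
    by (auto simp: B_def)
  have "closedin (top_of_set X) B"
    unfolding B_def using h by (rule continuous_closedin_preimage_constant)
  then have Bcomp: "compact B"
    using X closedin_compact by blast
  \<comment> \<open>On \<open>C\<close> the limit \<open>h\<close> has a positive minimum, so the
    distances to \<open>L (r n)\<close> are eventually positive there.\<close>
  have miss: "\<forall>\<^sub>F n in sequentially. L (r n) \<inter> C = {}" if C: "compact C" "C \<subseteq> X" "C \<inter> B = {}" for C
  proof (cases "C = {}")
    case False
    obtain c where c: "c \<in> C" "\<And>x. x \<in> C \<Longrightarrow> h c \<le> h x"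
      using continuous_attains_inf[OF C(1) False continuous_on_subset[OF h C(2)]] by blast
    have "h c > 0"
      using h0[of c] c(1) C by (force simp: B_def)
    from uniform_limitD[OF lim this] show ?thesis
    proof eventually_elim
      case (elim n)
      have "x \<notin> L (r n)" if "x \<in> C" for x
        using elim c(2)[OF that] \<open>h c > 0\<close> that C(2) by (force simp: dist_real_def)
      then show ?case by auto
    qed
  qed auto
  have near1: "\<forall>\<^sub>F n in sequentially. \<forall>x\<in>B. infdist x (L (r n)) < e" if "e > 0" for e
    using uniform_limitD[OF lim that]
    by eventually_elim (auto simp: B_def dist_real_def)
  have Bne: "B \<noteq> {}"
  proof
    assume "B = {}"
    then have "\<forall>\<^sub>F n in sequentially. L (r n) \<inter> X = {}"
      using miss[OF X] by auto
    then obtain n where "L (r n) \<inter> X = {}"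
      using eventually_happens'[OF sequentially_bot] by blast
    then show False
      using LX Lne by blast
  qed
  \<comment> \<open>The points of \<open>X\<close> at distance at least \<open>e\<close> from
    \<open>B\<close> form a compact set, to which \<open>miss\<close> applies.\<close>
  have near2: "\<forall>\<^sub>F n in sequentially. \<forall>x\<in>L (r n). infdist x B < e" if "e > 0" for e
  proof -
    have "closedin (top_of_set X) (X \<inter> (\<lambda>x. infdist x B) -` {e..})"
      by (intro continuous_closedin_preimage continuous_intros)
    then have "compact (X \<inter> (\<lambda>x. infdist x B) -` {e..})"
      using X closedin_compact by blast
    moreover have "X \<inter> (\<lambda>x. infdist x B) -` {e..} \<inter> B = {}"
      using that by auto
    ultimately have "\<forall>\<^sub>F n in sequentially. L (r n) \<inter> (X \<inter> (\<lambda>x. infdist x B) -` {e..}) = {}"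
      using miss by blast
    then show ?thesis
      by eventually_elim (use LX in force)
  qed
  have meets: "\<forall>\<^sub>F n in sequentially. L (r n) \<inter> U \<noteq> {}" if U: "open U" "b \<in> B" "b \<in> U" for U b
  proof -
    obtain e where "e > 0" "ball b e \<subseteq> U"
      using openE[OF U(1,3)] by blast
    from near1[OF this(1)] show ?thesis
    proof eventually_elim
      case (elim n)
      then have "infdist b (L (r n)) < e"
        using U by auto
      then obtain y where "y \<in> L (r n)" "dist b y < e"
        using Lne[of "r n"] by (auto simp: infdist_notempty cInf_less_iff)
      then show ?case
        using \<open>ball b e \<subseteq> U\<close> by auto
    qed
  qed
  \<comment> \<open>Disjoint open sets around the two pieces of a separation would eventually cover
    \<open>L (r n)\<close> and both meet it.\<close>
  have "connected B"
    unfolding connected_closedin_eq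
  proof (rule notI, elim exE conjE)
    fix P Q assume PQ: "closedin (top_of_set B) P" "closedin (top_of_set B) Q" "P \<union> Q = B" "P \<inter> Q = {}"
      "P \<noteq> {}" "Q \<noteq> {}"
    then have "compact P" "compact Q"
      using Bcomp closedin_compact by blast+
    then obtain U V where UV: "open U" "open V" "P \<subseteq> U" "Q \<subseteq> V" "U \<inter> V = {}"
      using t4_space[of P Q] PQ(4) compact_imp_closed by metis
    obtain p q where "p \<in> P" "q \<in> Q" using PQ by auto
    moreover have "\<forall>\<^sub>F n in sequentially. L (r n) \<inter> (X - (U \<union> V)) = {}"
      using X UV PQ by (intro miss compact_diff) auto
    ultimately have "\<forall>\<^sub>F n in sequentially. L (r n) \<inter> (X - (U \<union> V)) = {} \<and> L (r n) \<inter> U \<noteq> {} \<and> L (r n) \<inter> V \<noteq> {}"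
      using meets[OF UV(1), of p] meets[OF UV(2), of q] UV PQ by (intro eventually_conj) auto
    then obtain n where "L (r n) \<inter> (X - (U \<union> V)) = {}" "L (r n) \<inter> U \<noteq> {}" "L (r n) \<inter> V \<noteq> {}"
      using eventually_happens'[OF sequentially_bot] by blast
    then show False
      using connectedD[OF Lconn[of "r n"] UV(1,2)] LX[of "r n"] UV(5) by blast
  qed
  then have "subcontinuum B X"
    using BX Bcomp Bne by (simp add: subcontinuum_def continuum_def)
  moreover have "x \<in> B" if "\<And>n. x \<in> L n" for x
    using hlim[of x] that LX[of 0] by (auto simp: B_def LIMSEQ_const_iff)
  ultimately show ?thesis
    using that[OF r] hausdorff_dist_tendsto_0[OF Bne _ near2 near1] Lne miss by blast
qed


subsection \<open>Logarithms on Matea phans\<close>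

lemma arc_with_ends_iff_arc:
  "arc_with_ends A x y \<longleftrightarrow> (\<exists>p. arc p \<and> path_image p = A \<and> pathstart p = x \<and> pathfinish p = y)"
proof
  assume "arc_with_ends A x y"
  then obtain f g where fg: "homeomorphism {0..1::real} A f g" "f 0 = x" "f 1 = y"
    by (auto simp: arc_with_ends_def)
  then have "inj_on f {0..1}"
    by (metis homeomorphism_def inj_on_inverseI)
  with fg show "\<exists>p. arc p \<and> path_image p = A \<and> pathstart p = x \<and> pathfinish p = y"
    by (intro exI[of _ f])
       (auto simp: arc_def path_def path_image_def pathstart_def pathfinish_def homeomorphism_def)
next
  assume "\<exists>p. arc p \<and> path_image p = A \<and> pathstart p = x \<and> pathfinish p = y"
  then show "arc_with_ends A x y"
    unfolding arc_with_ends_def by (metis homeomorphism_arc pathfinish_def pathstart_def)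
qed

lemma is_arc_iff_arc: "is_arc A \<longleftrightarrow> (\<exists>p. arc p \<and> path_image p = A)"
proof -
  have "is_arc A \<longleftrightarrow> (\<exists>x y. arc_with_ends A x y)"
    unfolding is_arc_def arc_with_ends_def homeomorphic_sym[of A "{0..1}"] unfolding homeomorphic_def by blast
  then show ?thesis
    unfolding arc_with_ends_iff_arc by blast
qed

text \<open>A parametrization of \<open>L\<close> is composed with the straight path between the two
  parameters, whichever is larger.\<close>

lemma subarc_exists:
  assumes "is_arc L" "x \<in> L" "y \<in> L" "x \<noteq> y"
  obtains A where "A \<subseteq> L" "arc_with_ends A x y"
proof -
  obtain p where p: "arc p" "path_image p = L"
    using assms(1) is_arc_iff_arc by auto
  then obtain s t where st: "s \<in> {0..1}" "t \<in> {0..1}" "p s = x" "p t = y"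
    using assms(2,3) unfolding path_image_def by (metis imageE)
  then have "s \<noteq> t"
    using assms(4) by auto
  have img: "linepath s t ` {0..1} \<subseteq> {0..1}"
    using st path_image_linepath[of s t] by (auto simp: path_image_def closed_segment_eq_real_ivl split: if_splits)
  have "arc (p \<circ> linepath s t)"
    using p(1) arc_linepath[OF \<open>s \<noteq> t\<close>] img unfolding arc_def path_def
    by (meson comp_inj_on continuous_on_compose continuous_on_subset inj_on_subset)
  moreover have "path_image (p \<circ> linepath s t) \<subseteq> L"
    using img p(2) by (auto simp: path_image_def)
  ultimately show ?thesis
    using st by (intro that[of "path_image (p \<circ> linepath s t)"])
      (auto simp: arc_with_ends_iff_arc pathstart_compose pathfinish_compose)
qed

text \<open>Injectivity makes \<open>q\<close> monotone, which keeps interior values between the end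
  values; connectedness fills the gap.\<close>

lemma continuous_inj_image_eq_segment:
  fixes q :: "real \<Rightarrow> real"
  assumes q: "continuous_on {0..1} q" "inj_on q {0..1}"
  shows "q ` {0..1} = closed_segment (q 0) (q 1)"
proof
  show "q ` {0..1} \<subseteq> closed_segment (q 0) (q 1)"
  proof
    fix y assume "y \<in> q ` {0..1}"
    then obtain t where t: "t \<in> {0..1}" "y = q t" by auto
    then consider "t = 0" | "t = 1" | "0 < t" "t < 1" by force
    then show "y \<in> closed_segment (q 0) (q 1)"
    proof cases
      case 3
      from continuous_inj_imp_mono[OF this q] show ?thesis
        by (auto simp: t closed_segment_eq_real_ivl)
    qed (auto simp: t)
  qed
  have "connected (q ` {0..1})"
    using q by (intro connected_continuous_image) auto
  then show "closed_segment (q 0) (q 1) \<subseteq> q ` {0..1}"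
    by (intro closed_segment_subset) (auto simp flip: is_interval_connected_1 is_interval_convex_1)
qed

text \<open>In the coordinate \<open>p\<close> on \<open>L\<close>, any arc from \<open>x\<close> to
  \<open>y\<close> becomes the interval between \<open>p x\<close> and \<open>p y\<close>.\<close>

lemma arc_with_ends_unique:
  assumes L: "is_arc L" and A: "A \<subseteq> L" "arc_with_ends A x y" and B: "B \<subseteq> L" "arc_with_ends B x y"
  shows "A = B"
proof -
  obtain p q where pq: "homeomorphism L {0..1::real} p q"
    using L unfolding is_arc_def homeomorphic_def by auto
  have inj: "inj_on p L"
    using pq by (metis homeomorphism_def inj_on_inverseI)
  have img: "p ` C = closed_segment (p x) (p y)" if C: "C \<subseteq> L" "arc_with_ends C x y" for C
  proof -
    obtain f where f: "arc f" "path_image f = C" "pathstart f = x" "pathfinish f = y"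
      using C by (auto simp: arc_with_ends_iff_arc)
    then have fC: "f ` {0..1} = C"
      by (auto simp: path_image_def)
    have cf: "continuous_on {0..1} f" "inj_on f {0..1}"
      using f by (auto simp: arc_def path_def)
    have "continuous_on C p" "inj_on p C"
      using C pq inj by (meson continuous_on_subset homeomorphism_def inj_on_subset)+
    then have "continuous_on {0..1} (p \<circ> f)" "inj_on (p \<circ> f) {0..1}"
      using cf fC continuous_on_compose[of "{0..1}" f p] comp_inj_on[of f "{0..1}" p] by auto
    from continuous_inj_image_eq_segment[OF this] show ?thesis
      using fC f(3,4) unfolding image_comp[symmetric] by (simp add: pathstart_def pathfinish_def)
  qed
  have "p ` A = p ` B"
    using img A B by simp
  then show ?thesis
    using inj_on_image_eq_iff[OF inj] A B by blast
qed

lemma arc_with_ends_continuum: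
  assumes "arc_with_ends A x y"
  shows "continuum A" "x \<in> A" "y \<in> A"
proof -
  obtain p where p: "arc p" "path_image p = A" "pathstart p = x" "pathfinish p = y"
    using assms by (auto simp: arc_with_ends_iff_arc)
  then show "continuum A"
    by (intro is_arc_continuum) (auto simp: is_arc_iff_arc)
  show "x \<in> A" "y \<in> A"
    using p pathfinish_in_path_image pathstart_in_path_image by blast+
qed

section \<open>Members and segments of a pan\<close>

lemma pan_vertex_mem:
  assumes "pan X v \<L>" "L \<in> \<L>"
  shows "v \<in> L"
  using assms unfolding pan_def ramification_pair_def by blast

lemma pan_member_unique:
  assumes "pan X v \<L>" "L \<in> \<L>" "M \<in> \<L>" "x \<in> L" "x \<in> M" "x \<noteq> v"
  shows "L = M"
  using assms unfolding pan_def ramification_pair_def by blast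

text \<open>Resolves the definite description: a point other than \<open>v\<close> lies in one
  member only, and that member has only one arc from \<open>v\<close> to it.\<close>

lemma pan_segment_arc:
  assumes pan: "pan X v \<L>" and L: "L \<in> \<L>" "x \<in> L" "x \<noteq> v"
  shows "pan_segment \<L> v x \<subseteq> L" "arc_with_ends (pan_segment \<L> v x) v x"
proof -
  let ?P = "\<lambda>A. \<exists>L\<in>\<L>. v \<in> L \<and> x \<in> L \<and> A \<subseteq> L \<and> arc_with_ends A v x"
  have arcs: "is_arc L"
    using pan L by (auto simp: pan_def ramification_pair_def)
  have v: "v \<in> L"
    using pan_vertex_mem pan L by blast
  obtain A where "A \<subseteq> L" "arc_with_ends A v x"
    using subarc_exists[OF arcs v L(2)] L(3) by metis
  moreover have only: "C \<subseteq> L \<and> arc_with_ends C v x" if "?P C" for C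
    using that pan_member_unique[OF pan L(1) _ L(2) _ L(3)] by metis
  ultimately have "\<exists>!A. ?P A"
    using arc_with_ends_unique[OF arcs] v L by metis
  from theI'[OF this] have "?P (pan_segment \<L> v x)"
    using L(3) by (simp add: pan_segment_def)
  from only[OF this] show "pan_segment \<L> v x \<subseteq> L" "arc_with_ends (pan_segment \<L> v x) v x"
    by auto
qed

lemma Matea_phan_continuous_logarithm:
  fixes X :: "'a::metric_space set" and f :: "'a \<Rightarrow> complex"
  assumes M: "Matea_phan_wrt X v \<L>" and f: "continuous_on X f" and nz: "\<And>x. x \<in> X \<Longrightarrow> f x \<noteq> 0"
  obtains g where "continuous_on X g" "\<And>x. x \<in> X \<Longrightarrow> exp (g x) = f x"
proof -
  have pan: "pan X v \<L>"
    using M by (auto simp: Matea_phan_wrt_def phan_def)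
  have X: "compact X" and vX: "v \<in> X" and UL: "\<Union>\<L> = X" and arcs: "\<And>L. L \<in> \<L> \<Longrightarrow> is_arc L"
    using pan by (auto simp: pan_def ramification_pair_def continuum_def)
  have LX: "L \<subseteq> X" if "L \<in> \<L>" for L
    using UL that by auto
  define c where "c = Ln (f v)"
  have c: "exp c = f v"
    using nz vX by (simp add: c_def)
  have "\<exists>g. continuous_on L g \<and> (\<forall>x\<in>L. exp (g x) = f x) \<and> g v = c" if L: "L \<in> \<L>" for L
  proof -
    have "f x \<noteq> 0" if "x \<in> L" for x
      using LX[OF L] nz that by auto
    from continuous_logarithm_on_arc[OF arcs[OF L] continuous_on_subset[OF f LX[OF L]] this
        pan_vertex_mem[OF pan L] c]
    show ?thesis by metis
  qed
  then obtain G where G: "\<And>L. L \<in> \<L> \<Longrightarrow> continuous_on L (G L)"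
    "\<And>L x. \<lbrakk>L \<in> \<L>; x \<in> L\<rbrakk> \<Longrightarrow> exp (G L x) = f x" "\<And>L. L \<in> \<L> \<Longrightarrow> G L v = c"
    by metis
  have "\<forall>x\<in>X. \<exists>L. L \<in> \<L> \<and> x \<in> L"
    using UL by blast
  then obtain l where l: "\<And>x. x \<in> X \<Longrightarrow> l x \<in> \<L> \<and> x \<in> l x"
    by metis
  \<comment> \<open>The chosen member \<open>l x\<close> is ambiguous only at \<open>v\<close>,
    where all lifts have the value \<open>c\<close>.\<close>
  define h where "h x = G (l x) x" for x
  have h: "h x = G L x" if "L \<in> \<L>" "x \<in> L" for L x
  proof (cases "x = v")
    case True
    then show ?thesis using G(3) l vX that by (simp add: h_def)
  next
    case False
    then have "l x = L"
      using pan_member_unique[OF pan, of "l x" L x] l[of x] LX that by blast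
    then show ?thesis by (simp add: h_def)
  qed
  have "continuous_on X h"
  proof (rule ccontr)
    assume "\<not> continuous_on X h"
    then obtain a e where a: "a \<in> X" and e: "e > 0"
      and bad: "\<And>d. d > 0 \<Longrightarrow> \<exists>x\<in>X. dist x a < d \<and> \<not> dist (h x) (h a) < e"
      unfolding continuous_on_iff by metis
    have "\<exists>x\<in>X. dist x a < inverse (real (Suc n)) \<and> \<not> dist (h x) (h a) < e" for n
      using bad[of "inverse (real (Suc n))"] by simp
    then obtain x where xX: "\<And>n. x n \<in> X" and xa: "\<And>n. dist (x n) a < inverse (real (Suc n))"
      and xe: "\<And>n. \<not> dist (h (x n)) (h a) < e"
      by metis
    have xlim: "x \<longlonglongrightarrow> a"
      unfolding tendsto_dist_iff[of x]
      by (rule tendsto_sandwich[OF _ _ tendsto_const LIMSEQ_inverse_real_of_nat])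
         (use xa in \<open>auto intro!: always_eventually less_imp_le simp del: of_nat_Suc\<close>)
    have lL: "l (x n) \<in> \<L>" for n
      using l xX by blast
    have "subcontinuum (l (x n)) X" for n
      using lL[of n] LX arcs by (simp add: subcontinuum_def is_arc_continuum)
    then obtain r B where r: "strict_mono r" and B: "subcontinuum B X"
      and Hlim: "(\<lambda>n. hausdorff_dist (l (x (r n))) B) \<longlonglongrightarrow> 0"
      and miss: "\<And>C. \<lbrakk>compact C; C \<subseteq> X; C \<inter> B = {}\<rbrakk> \<Longrightarrow> \<forall>\<^sub>F n in sequentially. l (x (r n)) \<inter> C = {}"
      and com: "\<And>y. (\<And>n. y \<in> l (x n)) \<Longrightarrow> y \<in> B"
      using continua_hausdorff_convergent_subseq[OF X, of "\<lambda>n. l (x n)"] by blast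
    have Bcontr: "contractible B" and star: "\<And>b. b \<in> B \<Longrightarrow> pan_segment \<L> v b \<subseteq> B"
    proof -
      have "contractible B \<and> star_subcontinuum X v \<L> B"
        using M B Hlim lL unfolding Matea_phan_wrt_def by (elim conjE allE[of _ "\<lambda>n. l (x (r n))"]) auto
      then show "contractible B" "\<And>b. b \<in> B \<Longrightarrow> pan_segment \<L> v b \<subseteq> B"
        by (auto simp: star_subcontinuum_def)
    qed
    have BX: "B \<subseteq> X" and Bcomp: "compact B"
      using B by (auto simp: subcontinuum_def continuum_def)
    have vB: "v \<in> B"
      using com pan_vertex_mem[OF pan] lL by blast
    have xr: "(\<lambda>n. x (r n)) \<longlonglongrightarrow> a"
      using LIMSEQ_subseq_LIMSEQ[OF xlim r] by (simp add: o_def)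
    \<comment> \<open>Otherwise a small ball about \<open>a\<close> is eventually missed by the
      arcs, although it contains their points \<open>x (r n)\<close>.\<close>
    have aB: "a \<in> B"
    proof (rule ccontr)
      assume "a \<notin> B"
      then obtain d where d: "d > 0" "cball a d \<subseteq> - B"
        using open_contains_cball[of "- B"] compact_imp_closed[OF Bcomp] by auto
      then have "\<forall>\<^sub>F n in sequentially. l (x (r n)) \<inter> (X \<inter> cball a d) = {}"
        using X by (intro miss compact_Int_closed) auto
      moreover have "\<forall>\<^sub>F n in sequentially. dist (x (r n)) a < d"
        using tendstoD[OF xr d(1)] .
      ultimately have "\<forall>\<^sub>F n in sequentially. False"
        by eventually_elim (use l xX in \<open>force simp: dist_commute\<close>)
      then show False by simp
    qed
    obtain g0 where g0: "continuous_on B g0" "\<And>y. y \<in> B \<Longrightarrow> exp (g0 y) = f y"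
      using continuous_logarithm_on_compact_contractible[OF Bcomp Bcontr continuous_on_subset[OF f BX]] nz BX
      by (metis subsetD)
    \<comment> \<open>The shift has exponential 1 and makes \<open>g\<close> agree with the lifts at
      \<open>v\<close>.\<close>
    define g where "g y = g0 y + (c - g0 v)" for y
    have g: "continuous_on B g"
      unfolding g_def by (intro continuous_intros g0)
    have eg: "exp (g y) = f y" if "y \<in> B" for y
      using g0(2)[OF that] g0(2)[OF vB] c nz[OF vX] by (simp add: g_def exp_add exp_diff)
    obtain U H where U: "openin (top_of_set X) U" "B \<subseteq> U" and H: "continuous_on U H"
      "\<And>y. y \<in> U \<Longrightarrow> exp (H y) = f y" "\<And>y. y \<in> B \<Longrightarrow> H y = g y"
      using continuous_logarithm_extend_nhd[OF f BX Bcomp g eg] by blast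
    have Hv: "H v = c"
      using H(3)[OF vB] by (simp add: g_def)
    \<comment> \<open>The star property enters here: the segment from \<open>v\<close> to
      \<open>a\<close> stays in \<open>B\<close>, so \<open>H\<close> and the lift on
      \<open>l a\<close> can be compared along it, even if \<open>l a\<close> leaves
      \<open>U\<close>.\<close>
    have Ha: "H a = h a"
    proof (cases "a = v")
      case True
      then show ?thesis
        using Hv h[of "l v" v] l[OF vX] G(3) by simp
    next
      case False
      note seg = pan_segment_arc[OF pan conjunct1[OF l[OF a]] conjunct2[OF l[OF a]] False]
      note segc = arc_with_ends_continuum[OF seg(2)]
      have "H a = G (l a) a"
      proof (rule continuous_logarithm_unique[of "pan_segment \<L> v a" H "G (l a)" v])
        show "continuous_on (pan_segment \<L> v a) H"
          using H(1) star[OF aB] U(2) by (meson continuous_on_subset order_trans)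
        show "continuous_on (pan_segment \<L> v a) (G (l a))"
          using G(1) l[OF a] seg(1) continuous_on_subset by blast
        show "exp (H y) = exp (G (l a) y)" if "y \<in> pan_segment \<L> v a" for y
          using H(2)[of y] G(2)[of "l a" y] l[OF a] subsetD[OF seg(1) that]
            subsetD[OF U(2) subsetD[OF star[OF aB] that]] by simp
        show "H v = G (l a) v"
          using Hv G(3) l[OF a] by simp
      qed (use segc in \<open>auto simp: continuum_def\<close>)
      then show ?thesis
        by (simp add: h_def)
    qed
    \<comment> \<open>Eventually the whole arc lies in \<open>U\<close>, so \<open>H\<close> agrees
      with the lift from \<open>v\<close> out to \<open>x (r n)\<close>.\<close>
    have "compact (X - U)"
      using X U(1) by (auto simp: openin_closedin_eq intro: closedin_compact)
    then have "\<forall>\<^sub>F n in sequentially. l (x (r n)) \<inter> (X - U) = {}"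
      using U(2) by (intro miss) auto
    then have ev: "\<forall>\<^sub>F n in sequentially. x (r n) \<in> U \<and> H (x (r n)) = h (x (r n))"
    proof eventually_elim
      case (elim n)
      let ?L = "l (x (r n))"
      have LU: "?L \<subseteq> U"
        using elim LX[OF lL] by blast
      have "H (x (r n)) = G ?L (x (r n))"
      proof (rule continuous_logarithm_unique[of ?L H "G ?L" v])
        show "connected ?L"
          using is_arc_continuum[OF arcs[OF lL]] by (simp add: continuum_def)
        show "continuous_on ?L H"
          using H(1) LU continuous_on_subset by blast
        show "exp (H y) = exp (G ?L y)" if "y \<in> ?L" for y
          using that H(2)[of y] G(2)[OF lL] LU by auto
      qed (use G lL pan_vertex_mem[OF pan lL] Hv l xX in auto)
      then show ?case
        using LU l xX by (auto simp: h_def)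
    qed
    have "(\<lambda>n. H (x (r n))) \<longlonglongrightarrow> H a"
      using continuous_on_tendsto_compose[OF H(1) xr] subsetD[OF U(2) aB] eventually_mono[OF ev] by simp
    from tendstoD[OF this e] ev have "\<forall>\<^sub>F n in sequentially. False"
      by eventually_elim (use xe Ha in auto)
    then show False by simp
  qed
  moreover have "exp (h x) = f x" if "x \<in> X" for x
    using G(2) l[OF that] by (simp add: h_def)
  ultimately show ?thesis
    using that by blast
qed


subsection \<open>Separation in dimension one\<close>

text \<open>A form of dimension at most 0 for compact sets. Taking \<open>C\<close> and
  \<open>D\<close> closed in the whole type makes it pass easily to subsets and finite
  unions.\<close>

definition closed_separable :: "'a::topological_space set \<Rightarrow> bool" where
  "closed_separable K \<longleftrightarrow> (\<forall>A B. closed A \<and> closed B \<and> A \<inter> B = {} \<longrightarrow>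
     (\<exists>C D. closed C \<and> closed D \<and> C \<inter> D = {} \<and> A \<subseteq> C \<and> B \<subseteq> D \<and> K \<subseteq> C \<union> D))"

lemma closed_separable_subset: "\<lbrakk>closed_separable K; J \<subseteq> K\<rbrakk> \<Longrightarrow> closed_separable J"
  unfolding closed_separable_def by (meson order_trans)

text \<open>The enlarged sets obtained for \<open>J\<close> serve as the sets to be separated for
  \<open>K\<close>.\<close>

lemma closed_separable_Un:
  assumes "closed_separable J" "closed_separable K"
  shows "closed_separable (J \<union> K)"
  unfolding closed_separable_def
proof clarify
  fix A B :: "'a set" assume AB: "closed A" "closed B" "A \<inter> B = {}"
  obtain C D where CD: "closed C" "closed D" "C \<inter> D = {}" "A \<subseteq> C" "B \<subseteq> D" "J \<subseteq> C \<union> D"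
    using assms(1) AB unfolding closed_separable_def by metis
  moreover obtain C' D' where "closed C'" "closed D'" "C' \<inter> D' = {}" "C \<subseteq> C'" "D \<subseteq> D'" "K \<subseteq> C' \<union> D'"
    using assms(2) CD(1-3) unfolding closed_separable_def by metis
  ultimately show "\<exists>C D. closed C \<and> closed D \<and> C \<inter> D = {} \<and> A \<subseteq> C \<and> B \<subseteq> D \<and> J \<union> K \<subseteq> C \<union> D"
    by (intro exI[of _ C'] exI[of _ D']) auto
qed

lemma closed_separable_Union:
  "finite \<K> \<Longrightarrow> (\<And>K. K \<in> \<K> \<Longrightarrow> closed_separable K) \<Longrightarrow> closed_separable (\<Union>\<K>)"
proof (induction rule: finite_induct)
  case empty
  show ?case by (auto simp: closed_separable_def)
qed (auto intro: closed_separable_Un)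

text \<open>By compactness, finitely many clopen subsets of \<open>K\<close> that avoid
  \<open>B\<close> cover \<open>K \<inter> A\<close>. Their union and its complement in
  \<open>K\<close> are added to \<open>A\<close> and \<open>B\<close>.\<close>

lemma compact_dim_le_0_imp_closed_separable:
  fixes K :: "'a::metric_space set"
  assumes K: "compact K" and dim: "top_of_set K dim_le 0"
  shows "closed_separable K"
  unfolding closed_separable_def
proof clarify
  fix A B :: "'a set" assume AB: "closed A" "closed B" "A \<inter> B = {}"
  have KB: "openin (top_of_set K) (K - B)"
    using AB by (simp add: openin_diff closedin_closed_Int openin_open Diff_eq)  blast
  have nb: "neighbourhood_base_of (\<lambda>U. closedin (top_of_set K) U \<and> openin (top_of_set K) U) (top_of_set K)"
    using dim by (simp add: dimension_le_0_neighbourhood_base_of_clopen)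
  have "\<exists>U. closedin (top_of_set K) U \<and> openin (top_of_set K) U \<and> x \<in> U \<and> U \<subseteq> K - B" if "x \<in> K \<inter> A" for x
  proof -
    have "x \<in> K - B"
      using that AB by auto
    then show ?thesis
      using nb KB unfolding neighbourhood_base_of by (meson subsetD)
  qed
  then obtain U where U: "\<And>x. x \<in> K \<inter> A \<Longrightarrow> closedin (top_of_set K) (U x)"
    "\<And>x. x \<in> K \<inter> A \<Longrightarrow> openin (top_of_set K) (U x)"
    "\<And>x. x \<in> K \<inter> A \<Longrightarrow> x \<in> U x" "\<And>x. x \<in> K \<inter> A \<Longrightarrow> U x \<subseteq> K - B"
    by metis
  have "\<exists>F. finite F \<and> F \<subseteq> K \<inter> A \<and> K \<inter> A \<subseteq> (\<Union>x\<in>F. U x)"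
  proof -
    have "compactin (top_of_set K) (K \<inter> A)"
      using K AB by (simp add: compactin_subtopology compact_Int_closed)
    then obtain \<F> where "finite \<F>" "\<F> \<subseteq> U ` (K \<inter> A)" "K \<inter> A \<subseteq> \<Union>\<F>"
      using compactinD[of "top_of_set K" "K \<inter> A" "U ` (K \<inter> A)"] U(2,3) by blast
    then show ?thesis
      by (metis finite_subset_image)
  qed
  then obtain F where F: "finite F" "F \<subseteq> K \<inter> A" "K \<inter> A \<subseteq> (\<Union>x\<in>F. U x)"
    by blast
  define W where "W = (\<Union>x\<in>F. U x)"
  have Wcl: "closedin (top_of_set K) W"
    unfolding W_def using F U(1) by (intro closedin_Union) auto
  have Wop: "openin (top_of_set K) W"
    unfolding W_def using F U(2) by (intro openin_Union) auto
  have "closed W" "closed (K - W)"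
    using Wcl Wop K by (auto simp: openin_closedin_eq intro: closedin_compact compact_imp_closed)
  moreover have "W \<subseteq> K - B" "K \<inter> A \<subseteq> W"
    using U(4) F by (auto simp: W_def)
  ultimately show "\<exists>C D. closed C \<and> closed D \<and> C \<inter> D = {} \<and> A \<subseteq> C \<and> B \<subseteq> D \<and> K \<subseteq> C \<union> D"
    using AB by (intro exI[of _ "A \<union> W"] exI[of _ "B \<union> (K - W)"]) auto
qed

text \<open>Small inductive dimension gives small open sets around single points. Finitely many
  cover \<open>P\<close>, and the frontier of their union lies in the union of their
  frontiers.\<close>

lemma dim_le_1_separator:
  fixes X :: "'a::metric_space set"
  assumes X: "compact X" and dim: "top_of_set X dim_le 1"
    and PQ: "P \<subseteq> X" "closed P" "closed Q" "P \<inter> Q = {}"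
  obtains W where "openin (top_of_set X) W" "P \<subseteq> W" "Q \<inter> (top_of_set X) closure_of W = {}"
    "closed_separable ((top_of_set X) frontier_of W)"
proof -
  \<comment> \<open>Keeping \<open>W\<close> inside \<open>G\<close> leaves it in the closed set
    \<open>X - H\<close>, so its closure misses \<open>Q\<close> too.\<close>
  obtain G H where GH: "open G" "open H" "P \<subseteq> G" "Q \<subseteq> H" "G \<inter> H = {}"
    using t4_space[OF PQ(2-4)] by auto
  have XG: "openin (top_of_set X) (X \<inter> G)"
    using GH by (simp add: openin_open_Int)
  have "\<exists>U. x \<in> U \<and> U \<subseteq> X \<inter> G \<and> openin (top_of_set X) U \<and>
      subtopology (top_of_set X) ((top_of_set X) frontier_of U) dim_le 0" if "x \<in> P" for x
  proof -
    have "x \<in> X \<inter> G"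
      using that GH PQ by auto
    then show ?thesis
      using dim XG by (subst (asm) dimension_le.simps) auto
  qed
  then obtain U where U: "\<And>x. x \<in> P \<Longrightarrow> x \<in> U x" "\<And>x. x \<in> P \<Longrightarrow> U x \<subseteq> X \<inter> G"
    "\<And>x. x \<in> P \<Longrightarrow> openin (top_of_set X) (U x)"
    and Udim: "\<And>x. x \<in> P \<Longrightarrow> subtopology (top_of_set X) ((top_of_set X) frontier_of U x) dim_le 0"
    by metis
  have fr: "closed_separable ((top_of_set X) frontier_of U x)" if "x \<in> P" for x
  proof (rule compact_dim_le_0_imp_closed_separable)
    show "compact ((top_of_set X) frontier_of U x)"
      using X closedin_frontier_of closedin_compact by blast
    have "(top_of_set X) frontier_of U x \<subseteq> X"
      using frontier_of_subset_topspace[of "top_of_set X"] by simp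
    then show "top_of_set ((top_of_set X) frontier_of U x) dim_le 0"
      using Udim[OF that] by (simp add: subtopology_subtopology Int_absorb1)
  qed
  have "compactin (top_of_set X) P"
    using X PQ by (simp add: compactin_subtopology compact_Int_closed) (metis compact_Int_closed inf.absorb_iff2)
  then obtain \<F> where "finite \<F>" "\<F> \<subseteq> U ` P" "P \<subseteq> \<Union>\<F>"
    using compactinD[of "top_of_set X" P "U ` P"] U(1,3) by blast
  then obtain F where F: "finite F" "F \<subseteq> P" "P \<subseteq> (\<Union>x\<in>F. U x)"
    by (metis finite_subset_image)
  define W where "W = (\<Union>x\<in>F. U x)"
  show ?thesis
  proof
    show "openin (top_of_set X) W"
      unfolding W_def using F U(3) by (intro openin_Union) auto
    show "P \<subseteq> W"
      using F by (simp add: W_def)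
    have "closedin (top_of_set X) (X - H)"
      using closedin_closed_Int[of "- H" X] GH(2) by (simp add: Diff_eq closed_Compl)
    moreover have "W \<subseteq> X - H"
      using GH(5) U(2) F(2) unfolding W_def by blast
    ultimately have "(top_of_set X) closure_of W \<subseteq> X - H"
      by (intro closure_of_minimal)
    then show "Q \<inter> (top_of_set X) closure_of W = {}"
      using GH by auto
    have "(top_of_set X) frontier_of W \<subseteq> (\<Union>x\<in>F. (top_of_set X) frontier_of U x)"
      unfolding W_def using frontier_of_Union_subset[of "U ` F" "top_of_set X"] F(1) by auto
    then show "closed_separable ((top_of_set X) frontier_of W)"
      using closed_separable_Union[of "(\<lambda>x. (top_of_set X) frontier_of U x) ` F"] F(1,2) fr
      by (blast intro: closed_separable_subset)
  qed
qed

text \<open>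
  If the intersection splits into \<open>P\<close> and \<open>Q\<close>, pick a separator \<open>S\<close> of \<open>P\<close> and \<open>Q\<close> of dimension
  \<open>\<le> 0\<close>. The sets \<open>A\<close> and \<open>B\<close> meet \<open>S\<close> in disjoint closed sets, so \<open>S\<close> splits into a part containing
  the trace of \<open>A\<close> and a part containing the trace of \<open>B\<close>. A function whose real part changes sign
  exactly at \<open>S\<close> and whose imaginary part is \<open>1\<close> and \<open>-1\<close> on these two parts winds around \<open>0\<close> along
  \<open>A \<union> B\<close>, hence has no logarithm.
\<close>

lemma connected_Int_if_continuous_logarithms:
  fixes X :: "'a::metric_space set"
  assumes X: "compact X" and dim: "top_of_set X dim_le 1"
    and logs: "\<And>f. \<lbrakk>continuous_on X f; \<And>x. x \<in> X \<Longrightarrow> f x \<noteq> 0\<rbrakk> \<Longrightarrow>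
      \<exists>g. continuous_on X g \<and> (\<forall>x\<in>X. exp (g x) = (f x :: complex))"
    and A: "subcontinuum A X" and B: "subcontinuum B X"
  shows "connected (A \<inter> B)"
  unfolding connected_closedin_eq
proof (rule notI, elim exE conjE)
  fix P Q assume cl: "closedin (top_of_set (A \<inter> B)) P" "closedin (top_of_set (A \<inter> B)) Q"
    and "P \<union> Q = A \<inter> B" and PQ': "P \<inter> Q = {}" "P \<noteq> {}" "Q \<noteq> {}"
  note PQ = \<open>P \<union> Q = A \<inter> B\<close>[symmetric] PQ'
  have AX: "A \<subseteq> X" "compact A" "connected A" and BX: "B \<subseteq> X" "compact B" "connected B"
    using A B by (auto simp: subcontinuum_def continuum_def)
  have "compact P" "compact Q"
    using cl closedin_compact compact_Int AX BX by blast+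
  then have cPQ: "closed P" "closed Q"
    by (auto intro: compact_imp_closed)
  obtain W where W: "openin (top_of_set X) W" "P \<subseteq> W" "Q \<inter> (top_of_set X) closure_of W = {}"
    and sep: "closed_separable ((top_of_set X) frontier_of W)"
    using dim_le_1_separator[OF X dim _ cPQ PQ(2)] PQ(1) AX(1) by blast
  define V where "V = (top_of_set X) closure_of W"
  define S where "S = (top_of_set X) frontier_of W"
  have WX: "W \<subseteq> X"
    using openin_imp_subset[OF W(1)] .
  have WV: "W \<subseteq> V"
    unfolding V_def using WX by (intro closure_of_subset) auto
  have VX: "V \<subseteq> X"
    unfolding V_def using closure_of_subset_topspace[of "top_of_set X"] by simp
  have SV: "S = V - W"
    unfolding S_def V_def using frontier_of_openin[OF W(1)] .
  have cV: "closed V" and cXW: "closed (X - W)"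
    using closedin_compact[OF X, of V] closedin_compact[OF X, of "X - W"] W(1) closedin_closure_of[of "top_of_set X" W]
    by (auto simp: openin_closedin_eq V_def intro: compact_imp_closed)
  have cS: "closed S"
    using X unfolding S_def by (meson closedin_compact closedin_frontier_of compact_imp_closed)
  \<comment> \<open>The traces are disjoint because \<open>A \<inter> B\<close> is
    \<open>P \<union> Q\<close>, while \<open>S\<close> misses \<open>P\<close> (inside
    \<open>W\<close>) and \<open>Q\<close> (outside \<open>V\<close>).\<close>
  have "closed (A \<inter> S)" "closed (B \<inter> S)" "(A \<inter> S) \<inter> (B \<inter> S) = {}"
    using AX BX cS PQ W(2,3) SV by (auto simp: compact_imp_closed V_def)
  then obtain C D where CD: "closed C" "closed D" "C \<inter> D = {}" "A \<inter> S \<subseteq> C" "B \<inter> S \<subseteq> D" "S \<subseteq> C \<union> D"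
    using sep unfolding closed_separable_def S_def by metis
  have nrm: "normal_space (euclidean :: 'a topology)"
    by (simp add: metrizable_imp_normal_space metrizable_space_euclidean)
  have "closedin euclidean D" "closedin euclidean C" "disjnt D C" "-1 \<le> (1::real)"
    using CD by (auto simp: disjnt_def)
  then obtain \<psi> where "continuous_map euclidean (top_of_set {-1..1::real}) \<psi>" "\<psi> ` D \<subseteq> {-1}" "\<psi> ` C \<subseteq> {1}"
    by (rule Urysohn_lemma[OF nrm])
  then have \<psi>: "continuous_on X \<psi>" and \<psi>C: "\<And>x. x \<in> C \<Longrightarrow> \<psi> x = 1" and \<psi>D: "\<And>x. x \<in> D \<Longrightarrow> \<psi> x = -1"
    by (auto simp: continuous_map_in_subtopology intro: continuous_on_subset)
  \<comment> \<open>Positive on \<open>W\<close> and negative on \<open>X - V\<close>, so its zeros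
    in \<open>X\<close> lie in \<open>S\<close>.\<close>
  define \<phi> where "\<phi> x = infdist x (X - W) - infdist x V" for x
  obtain p q where pq: "p \<in> P" "q \<in> Q"
    using PQ by auto
  have qX: "q \<in> X - W" and pV: "p \<in> V"
    using pq W PQ(1) AX(1) WV by (auto simp: V_def)
  have \<phi>W: "\<phi> x > 0" if "x \<in> W" for x
    using infdist_pos_not_in_closed[OF cXW, of x] infdist_zero[of x V] qX that subsetD[OF WV that]
    by (auto simp: \<phi>_def simp del: infdist_zero)
  have \<phi>V: "\<phi> x < 0" if "x \<in> X - V" for x
    using infdist_pos_not_in_closed[OF cV, of x] infdist_zero[of x "X - W"] pV that contra_subsetD[OF WV, of x]
    by (auto simp: \<phi>_def simp del: infdist_zero)
  have \<phi>S: "x \<in> S" if "x \<in> X" "\<phi> x = 0" for x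
    using \<phi>W[of x] \<phi>V[of x] that by (auto simp: SV)
  have "continuous_on X (\<lambda>x. Complex (\<phi> x) (\<psi> x))"
    unfolding Complex_eq \<phi>_def by (intro continuous_intros \<psi>)
  moreover have "Complex (\<phi> x) (\<psi> x) \<noteq> 0" if "x \<in> X" for x
    using \<phi>S[OF that] CD(6) \<psi>C[of x] \<psi>D[of x] by (auto simp: complex_eq_iff)
  ultimately obtain g where g: "continuous_on X g" and eg: "\<And>x. x \<in> X \<Longrightarrow> exp (g x) = Complex (\<phi> x) (\<psi> x)"
    using logs[of "\<lambda>x. Complex (\<phi> x) (\<psi> x)"] by blast
  \<comment> \<open>A continuous argument of the function: \<open>cos\<close> and \<open>sin\<close>
    of it carry the signs of \<open>\<phi>\<close> and \<open>\<psi>\<close>.\<close>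
  define \<theta> where "\<theta> x = Im (g x)" for x
  have \<theta>: "continuous_on X \<theta>"
    unfolding \<theta>_def by (intro continuous_intros g)
  have \<phi>\<theta>: "\<phi> x = exp (Re (g x)) * cos (\<theta> x)" and \<psi>\<theta>: "\<psi> x = exp (Re (g x)) * sin (\<theta> x)" if "x \<in> X" for x
    using eg[OF that] Re_exp[of "g x"] Im_exp[of "g x"] by (auto simp: \<theta>_def)
  have segment: "closed_segment (\<theta> p) (\<theta> q) \<subseteq> \<theta> ` E" if "connected E" "E \<subseteq> X" "p \<in> E" "q \<in> E" for E
  proof -
    have "connected (\<theta> ` E)"
      using that \<theta> by (meson connected_continuous_image continuous_on_subset)
    then show ?thesis
      using that by (intro closed_segment_subset) (auto simp flip: is_interval_connected_1 is_interval_convex_1)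
  qed
  \<comment> \<open>Both \<open>A\<close> and \<open>B\<close> join \<open>p\<close> to
    \<open>q\<close>, so each attains the argument \<open>t\<close>. If \<open>cos t = 0\<close>,
    both points lie in \<open>S\<close>, where \<open>\<psi>\<close> is 1 on \<open>A\<close> and -1
    on \<open>B\<close>; then \<open>sin t\<close> would have both signs.\<close>
  have noroot: "cos t \<noteq> 0" if t: "t \<in> closed_segment (\<theta> p) (\<theta> q)" for t
  proof
    assume c0: "cos t = 0"
    have "p \<in> A \<inter> B" "q \<in> A \<inter> B"
      using pq PQ(1) by auto
    then have "t \<in> \<theta> ` A" "t \<in> \<theta> ` B"
      using subsetD[OF segment[OF AX(3,1)] t] subsetD[OF segment[OF BX(3,1)] t] by auto
    then obtain a b where ab: "a \<in> A" "t = \<theta> a" "b \<in> B" "t = \<theta> b"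
      by blast
    then have "a \<in> X" "b \<in> X" "a \<in> S" "b \<in> S"
      using AX BX \<phi>\<theta> c0 \<phi>S by auto
    then have "exp (Re (g a)) * sin t = 1" "exp (Re (g b)) * sin t = -1"
      using ab \<psi>\<theta>[of a] \<psi>\<theta>[of b] \<psi>C[of a] \<psi>D[of b] CD by auto
    then show False
      using exp_gt_zero[of "Re (g a)"] exp_gt_zero[of "Re (g b)"]
      by (smt (verit) mult_nonneg_nonneg mult_nonneg_nonpos)
  qed
  have "cos (\<theta> p) > 0" "cos (\<theta> q) < 0"
  proof -
    have "p \<in> W" "q \<in> X - V"
      using pq W(2,3) qX by (auto simp: V_def)
    then show "cos (\<theta> p) > 0" "cos (\<theta> q) < 0"
      using \<phi>\<theta>[of p] \<phi>\<theta>[of q] \<phi>W[of p] \<phi>V[of q] WX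
      by (auto simp: zero_less_mult_iff mult_less_0_iff)
  qed
  moreover have "connected (cos ` closed_segment (\<theta> p) (\<theta> q))"
    by (intro connected_continuous_image continuous_intros) auto
  ultimately have "0 \<in> cos ` closed_segment (\<theta> p) (\<theta> q)"
    unfolding connected_iff_interval by (meson ends_in_segment imageI less_imp_le)
  then show False
    using noroot by force
qed


subsection \<open>Pans whose subcontinua have connected intersections\<close>

lemma continuum_Un:
  assumes "continuum A" "continuum B" "A \<inter> B \<noteq> {}"
  shows "continuum (A \<union> B)"
  using assms by (auto simp: continuum_def compact_Un connected_Un)

text \<open>If \<open>J\<close> reached another member \<open>M\<close>, then \<open>L\<close> and
  \<open>M\<close>, which meet only in \<open>v\<close>, would disconnect the intersection of
  \<open>J\<close> with the continuum \<open>L \<union> M\<close>.\<close>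

lemma pan_subcontinuum_subset_member:
  assumes pan: "pan X v \<L>" and Int: "\<And>A B. \<lbrakk>subcontinuum A X; subcontinuum B X\<rbrakk> \<Longrightarrow> connected (A \<inter> B)"
    and J: "subcontinuum J X" "v \<notin> J" "x \<in> J" and L: "L \<in> \<L>" "x \<in> L"
  shows "J \<subseteq> L"
proof
  fix y assume y: "y \<in> J"
  have props: "subcontinuum M X" if "M \<in> \<L>" for M
    using pan that by (auto simp: pan_def ramification_pair_def subcontinuum_def is_arc_continuum)
  obtain M where M: "M \<in> \<L>" "y \<in> M"
    using pan J(1) y unfolding pan_def ramification_pair_def subcontinuum_def by blast
  show "y \<in> L"
  proof (cases "M = L")
    case False
    then have LM: "L \<inter> M = {v}"
      using pan L M by (auto simp: pan_def ramification_pair_def)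
    have "subcontinuum (L \<union> M) X"
      using props[OF L(1)] props[OF M(1)] LM continuum_Un[of L M] by (auto simp: subcontinuum_def)
    then have conn: "connected (J \<inter> (L \<union> M))"
      using Int J(1) by blast
    have "closed L" "closed M"
      using props L M by (auto simp: subcontinuum_def continuum_def compact_imp_closed)
    moreover have "L \<inter> M \<inter> (J \<inter> (L \<union> M)) = {}"
      using LM J(2) by auto
    ultimately have "L \<inter> (J \<inter> (L \<union> M)) = {} \<or> M \<inter> (J \<inter> (L \<union> M)) = {}"
      using connected_closedD[OF conn, of L M] by auto
    then show ?thesis
      using J(3) L(2) M(2) y by auto
  qed (use M in auto)
qed

text \<open>On a line, two of three legs leaving a point go the same way and overlap. Only legs of
  length \<open>e\<close> are required in \<open>D\<close>, because only a small triod is known to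
  lie in one member.\<close>

lemma triod_not_in_arc:
  fixes f :: "real \<times> real \<Rightarrow> 'a::metric_space"
  assumes L: "is_arc L" and e: "0 < e"
    and f: "continuous_on D f" "inj_on f D" "f ` D \<subseteq> L"
    and D: "\<And>u t. \<lbrakk>u \<in> {(-1, 0), (1, 0), (0, 1)}; t \<in> {0..e}\<rbrakk> \<Longrightarrow> t *\<^sub>R u \<in> D"
  shows False
proof -
  let ?dirs = "{(-1, 0), (1, 0), (0, 1)} :: (real \<times> real) set"
  obtain p q where pq: "homeomorphism L {0..1::real} p q"
    using L unfolding is_arc_def homeomorphic_def by auto
  define k where "k = p \<circ> f"
  have kc: "continuous_on D k"
    unfolding k_def using f pq by (meson continuous_on_compose continuous_on_subset homeomorphism_def)
  have "inj_on p (f ` D)"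
    using f(3) pq by (metis homeomorphism_def inj_on_inverseI inj_on_subset)
  then have ki: "inj_on k D"
    unfolding k_def using f by (intro comp_inj_on)
  have dirs: "u = w" if "u \<in> ?dirs" "w \<in> ?dirs" "0 < s" "0 \<le> t" "s *\<^sub>R u = t *\<^sub>R w" for u w and s t :: real
    using that by auto
  define c where "c = k (0, 0)"
  have seg: "closed_segment c (k (e *\<^sub>R u)) \<subseteq> (\<lambda>t. k (t *\<^sub>R u)) ` {0..e}" if u: "u \<in> ?dirs" for u
  proof -
    have "continuous_on {0..e} (\<lambda>t. k (t *\<^sub>R u))"
      using D[OF u] by (intro continuous_on_compose2[OF kc] continuous_intros) auto
    then have "connected ((\<lambda>t. k (t *\<^sub>R u)) ` {0..e})"
      by (intro connected_continuous_image) auto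
    moreover have "c \<in> (\<lambda>t. k (t *\<^sub>R u)) ` {0..e}" "k (e *\<^sub>R u) \<in> (\<lambda>t. k (t *\<^sub>R u)) ` {0..e}"
      using e by (force simp: c_def zero_prod_def)+
    ultimately show ?thesis
      by (intro closed_segment_subset) (auto simp flip: is_interval_connected_1 is_interval_convex_1)
  qed
  \<comment> \<open>The image of a leg covers the segment to its tip, so a foreign tip in it would
    violate injectivity.\<close>
  have notin: "k (e *\<^sub>R u) \<notin> closed_segment c (k (e *\<^sub>R w))" if u: "u \<in> ?dirs" and w: "w \<in> ?dirs" and "u \<noteq> w" for u w
  proof
    assume "k (e *\<^sub>R u) \<in> closed_segment c (k (e *\<^sub>R w))"
    then obtain t where t: "t \<in> {0..e}" "k (e *\<^sub>R u) = k (t *\<^sub>R w)"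
      using seg[OF w] by blast
    then have "e *\<^sub>R u = t *\<^sub>R w"
      using ki D[OF u, of e] D[OF w t(1)] e by (auto simp: inj_on_def)
    then show False
      using dirs[OF u w e] t(1) \<open>u \<noteq> w\<close> by auto
  qed
  define a1 a2 a3 where "a1 = k (e *\<^sub>R (-1, 0))" and "a2 = k (e *\<^sub>R (1, 0))" and "a3 = k (e *\<^sub>R (0, 1))"
  \<comment> \<open>Two of the three tips are on the same side of \<open>c\<close>, and the nearer
    one lies in the segment to the farther.\<close>
  have "a1 \<notin> closed_segment c a2" "a2 \<notin> closed_segment c a1" "a1 \<notin> closed_segment c a3"
    "a3 \<notin> closed_segment c a1" "a2 \<notin> closed_segment c a3" "a3 \<notin> closed_segment c a2"
    unfolding a1_def a2_def a3_def by (intro notin; simp)+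
  then show False
    unfolding closed_segment_eq_real_ivl by (auto split: if_splits)
qed

text \<open>Away from \<open>v\<close>, short legs of a triod are continua through \<open>x\<close>
  that avoid \<open>v\<close>, so all of them lie in one arc.\<close>

lemma pan_ramification_point:
  assumes pan: "pan X v \<L>" and Int: "\<And>A B. \<lbrakk>subcontinuum A X; subcontinuum B X\<rbrakk> \<Longrightarrow> connected (A \<inter> B)"
    and x: "ramification_point X x"
  shows "x = v"
proof (rule ccontr)
  assume "x \<noteq> v"
  obtain T f g where T: "T \<subseteq> X" "homeomorphism standard_triod T f g" "f (0, 0) = x" and xX: "x \<in> X"
    using x unfolding ramification_point_def simple_triod_with_top_def by blast
  have f: "continuous_on standard_triod f" "inj_on f standard_triod" "f ` standard_triod = T"
    using T(2) by (auto simp: homeomorphism_def intro: inj_on_inverseI)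
  have 0: "(0, 0) \<in> standard_triod"
    by (auto simp: standard_triod_def)
  obtain d where d: "d > 0" "\<And>y. \<lbrakk>y \<in> standard_triod; dist y (0, 0) < d\<rbrakk> \<Longrightarrow> dist (f y) x < dist v x"
    using f(1) 0 \<open>x \<noteq> v\<close> T(3) unfolding continuous_on_iff by (metis zero_less_dist_iff)
  \<comment> \<open>The bound 1 keeps the legs in the triod; the bound \<open>d/2\<close> keeps
    their images off \<open>v\<close>.\<close>
  define e where "e = min 1 (d/2)"
  have e: "0 < e" "e \<le> 1" "e < d"
    using d(1) by (auto simp: e_def)
  let ?dirs = "{(-1, 0), (1, 0), (0, 1)} :: (real \<times> real) set"
  define leg where "leg u = (\<lambda>t. t *\<^sub>R u) ` {0..e}" for u :: "real \<times> real"
  have leg: "leg u \<subseteq> standard_triod" if "u \<in> ?dirs" for u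
    using that e by (auto simp: leg_def standard_triod_def)
  obtain L where L: "L \<in> \<L>" "x \<in> L"
    using pan xX unfolding pan_def ramification_pair_def by blast
  have "f ` leg u \<subseteq> L" if u: "u \<in> ?dirs" for u
  proof (rule pan_subcontinuum_subset_member[OF pan Int _ _ _ L])
    have "continuous_on {0..e} (\<lambda>t. f (t *\<^sub>R u))"
      using leg[OF u] by (intro continuous_on_compose2[OF f(1)] continuous_intros) (auto simp: leg_def)
    then have "compact ((\<lambda>t. f (t *\<^sub>R u)) ` {0..e})" "connected ((\<lambda>t. f (t *\<^sub>R u)) ` {0..e})"
      by (auto intro: compact_continuous_image connected_continuous_image)
    moreover have "f ` leg u = (\<lambda>t. f (t *\<^sub>R u)) ` {0..e}"
      by (auto simp: leg_def)
    moreover have "f ` leg u \<subseteq> X"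
      using leg[OF u] f(3) T(1) by blast
    ultimately show "subcontinuum (f ` leg u) X"
      using e by (auto simp: subcontinuum_def continuum_def)
    have "dist (t *\<^sub>R u) (0, 0) < d" if "t \<in> {0..e}" for t
      using u that e by (auto simp: dist_Pair_Pair)
    then show "v \<notin> f ` leg u"
      using d(2) leg[OF u] by (fastforce simp: leg_def)
    have "(0, 0) \<in> leg u"
      using e by (auto simp: leg_def zero_prod_def intro!: image_eqI[of _ _ 0])
    then show "x \<in> f ` leg u"
      using T(3) by auto
  qed auto
  then have fL: "f ` (\<Union>u\<in>?dirs. leg u) \<subseteq> L"
    by auto
  have sub: "(\<Union>u\<in>?dirs. leg u) \<subseteq> standard_triod"
    using leg by blast
  have "is_arc L"
    using pan L by (auto simp: pan_def ramification_pair_def)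
  from triod_not_in_arc[OF this e(1) continuous_on_subset[OF f(1) sub] inj_on_subset[OF f(2) sub] fL]
  show False
    by (force simp: leg_def)
qed

lemma pan_arcwise_connected:
  assumes pan: "pan X v \<L>"
  shows "arcwise_connected X"
  unfolding arcwise_connected_def
proof (intro ballI impI)
  fix x y assume xy: "x \<in> X" "y \<in> X" "x \<noteq> y"
  have UL: "\<Union>\<L> = X" and arcs: "\<And>L. L \<in> \<L> \<Longrightarrow> is_arc L"
    using pan by (auto simp: pan_def ramification_pair_def)
  obtain L M where LM: "L \<in> \<L>" "M \<in> \<L>" "x \<in> L" "y \<in> M"
    using UL xy by blast
  have LX: "L \<subseteq> X" "M \<subseteq> X"
    using UL LM by auto
  note v = pan_vertex_mem[OF pan LM(1)] pan_vertex_mem[OF pan LM(2)]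
  \<comment> \<open>The first two cases also absorb \<open>x = v\<close> and \<open>y = v\<close>.
    In the third, subarcs to \<open>v\<close> in distinct members meet only there and can be
    joined.\<close>
  consider "y \<in> L" | "x \<in> M" | "y \<notin> L" "x \<notin> M" by blast
  then show "\<exists>A\<subseteq>X. arc_with_ends A x y"
  proof cases
    case 1
    then show ?thesis
      using subarc_exists[OF arcs[OF LM(1)] LM(3) 1 xy(3)] LX by (metis order_trans)
  next
    case 2
    then show ?thesis
      using subarc_exists[OF arcs[OF LM(2)] 2 LM(4) xy(3)] LX by (metis order_trans)
  next
    case 3
    then have ne: "x \<noteq> v" "v \<noteq> y" "L \<noteq> M"
      using v LM by auto
    then have int: "L \<inter> M = {v}"
      using pan LM by (auto simp: pan_def ramification_pair_def)
    obtain A where A: "A \<subseteq> L" "arc_with_ends A x v"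
      using subarc_exists[OF arcs[OF LM(1)] LM(3) v(1) ne(1)] .
    obtain B where B: "B \<subseteq> M" "arc_with_ends B v y"
      using subarc_exists[OF arcs[OF LM(2)] v(2) LM(4) ne(2)] .
    obtain p where p: "arc p" "path_image p = A" "pathstart p = x" "pathfinish p = v"
      using A(2) by (auto simp: arc_with_ends_iff_arc)
    obtain q where q: "arc q" "path_image q = B" "pathstart q = v" "pathfinish q = y"
      using B(2) by (auto simp: arc_with_ends_iff_arc)
    have "arc (p +++ q)"
      using p q A(1) B(1) int by (intro arc_join) auto
    moreover have "path_image (p +++ q) = A \<union> B"
      using p q by (simp add: path_image_join)
    ultimately have "arc_with_ends (A \<union> B) x y"
      unfolding arc_with_ends_iff_arc using p q by (metis pathstart_join pathfinish_join)
    then show ?thesis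
      using A(1) B(1) LX by (intro exI[of _ "A \<union> B"]) auto
  qed
qed

theorem corollary4p16:
  fixes X :: "'a::metric_space set"
  assumes "continuum X"
    and "Matea_phan X"
  shows "fan X"
proof -
  obtain v \<L> where M: "Matea_phan_wrt X v \<L>"
    using assms(2) by (auto simp: Matea_phan_def)
  then have pan: "pan X v \<L>" and dim: "top_of_set X dim_le 1"
    by (auto simp: Matea_phan_wrt_def phan_def has_dimension_def)
  have X: "compact X"
    using assms(1) by (simp add: continuum_def)
  have Int: "connected (A \<inter> B)" if "subcontinuum A X" "subcontinuum B X" for A B
    using connected_Int_if_continuous_logarithms[OF X dim _ that]
      Matea_phan_continuous_logarithm[OF M] by metis
  \<comment> \<open>Connected intersections for all pairs of subcontinua of \<open>X\<close> thus
    give unicoherence of every subcontinuum at once.\<close>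
  have "subcontinuum A X" if "subcontinuum Z X" "subcontinuum A Z" for A Z
    using that by (auto simp: subcontinuum_def)
  then have "hereditarily_unicoherent X"
    unfolding hereditarily_unicoherent_def unicoherent_def using Int by blast
  then show ?thesis
    unfolding fan_def dendroid_def
    using assms(1) pan_arcwise_connected[OF pan] pan_ramification_point[OF pan Int] by blast
qed

end
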